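(* Let $M_5$ be the Turing machine with states $A,B,C,D$ (plus halting state $H$) and the 6 symbols $b,1,x,a,z,r$ defined in the context. The $3x+1$ conjecture is true if and only if, for all positive integers $n$, the Turing machine $M_5$ halts on the initial configuration ${}^\omega b(A1)1^{n-1}b^\omega$.
   Context: The $3x+1$ function $T$ on positive integers is $T(m)=m/2$ if $m$ is even and $T(m)=(3m+1)/2$ if $m$ is odd. The $3x+1$ conjecture is the assertion that, when $T$ is iterated from any positive integer, the loop $2\mapsto 1\mapsto 2$ is always reached (i.e. for every positive integer $m$ some iterate $T^j(m)$, $j\ge 0$, lies in $\{1,2\}$; equivalently some iterate equals $1$). Turing machines have one tape, infinite on both sides, made of cells containing symbols, one read/write head, a set $Q$ of states plus a halting state $H$, a set $\Sigma$ of symbols containing a blank symbol $b$, and a next move function $\delta$. If $\delta(p,s)=(s',\Delta,q)$ then the machine, reading symbol $s$ in state $p$, replaces $s$ by $s'$, moves one cell in direction $\Delta\in\{L,R\}$ ($L$ = left, $R$ = right), and enters state $q$. The machine halts when it enters state $H$. The configuration ${}^\omega b(A1)1^{n-1}b^\omega$ is the one in which the word $1^n$ is written on the tape between two infinite strings of blanks, the machine is in state $A$, and the head is on the leftmost $1$. The machine $M_5$ has $Q=\{A,B,C,D\}$, $\Sigma=\{b,1,x,a,z,r\}$ (blank $b$), and the following transitions, where "$s'\Delta q$" in row $p$ and column $s$ means $\delta(p,s)=(s',\Delta,q)$; pairs (state, symbol) not listed have no transition defined (and reaching such a pair does not count as halting): Row $A$: on $b$: $bRA$; on $1$: $xRD$;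 on $x$: $1LA$; on $a$: $1LA$; on $z$: $rRB$. Row $B$: on $b$: $1LB$; on $1$: $aRC$; on $x$: $1LB$; on $a$: $1LA$; on $z$: $xRB$; on $r$: $bRA$. Row $C$: on $b$: $zLC$; on $1$: $xRC$; on $x$: $1LC$; on $a$: $aRA$; on $z$: $rRC$; on $r$: $zLC$. Row $D$: on $b$: $bLH$; on $1$: $aRC$; on $z$: $xRB$. *)

theory Defs
  imports Main
begin

definition collatz_T :: "nat \<Rightarrow> nat" where
  "collatz_T m = (if even m then m div 2 else (3 * m + 1) div 2)"

definition collatz_conjecture :: bool where
  "collatz_conjecture \<longleftrightarrow> (\<forall>m>0. \<exists>j. (collatz_T ^^ j) m \<in> {1, 2})"

datatype direction = L | R

text \<open>The type \<open>'q\<close> is the set of ordinary states; the halting state is adjoined to it.\<close>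

datatype 'q control = State 'q | Halt

text \<open>Next move functions are partial: a machine that reaches a pair with value \<open>None\<close>
  is stuck, which does not count as halting.\<close>

type_synonym ('q, 's) machine = "'q \<Rightarrow> 's \<Rightarrow> ('s \<times> direction \<times> 'q control) option"

text \<open>Control state, contents of the two-sided infinite tape, and position of the head.\<close>

type_synonym ('q, 's) config = "'q control \<times> (int \<Rightarrow> 's) \<times> int"

fun move :: "direction \<Rightarrow> int \<Rightarrow> int" where
  "move L i = i - 1"
| "move R i = i + 1"

inductive step :: "('q, 's) machine \<Rightarrow> ('q, 's) config \<Rightarrow> ('q, 's) config \<Rightarrow> bool"
  for M :: "('q, 's) machine" where
  "M p (tape i) = Some (s', d, q) \<Longrightarrow>
    step M (State p, tape, i) (q, tape(i := s'), move d i)"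

definition halts :: "('q, 's) machine \<Rightarrow> ('q, 's) config \<Rightarrow> bool" where
  "halts M c \<longleftrightarrow> (\<exists>tape i. (step M)\<^sup>*\<^sup>* c (Halt, tape, i))"

datatype state5 = QA | QB | QC | QD

text \<open>The symbols \<open>b\<close> (the blank), \<open>1\<close>, \<open>x\<close>, \<open>a\<close>, \<open>z\<close>, \<open>r\<close>.\<close>

datatype symbol5 = Sb | S1 | Sx | Sa | Sz | Sr

fun M5 :: "(state5, symbol5) machine" where
  "M5 QA Sb = Some (Sb, R, State QA)"
| "M5 QA S1 = Some (Sx, R, State QD)"
| "M5 QA Sx = Some (S1, L, State QA)"
| "M5 QA Sa = Some (S1, L, State QA)"
| "M5 QA Sz = Some (Sr, R, State QB)"
| "M5 QA Sr = None"
| "M5 QB Sb = Some (S1, L, State QB)"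
| "M5 QB S1 = Some (Sa, R, State QC)"
| "M5 QB Sx = Some (S1, L, State QB)"
| "M5 QB Sa = Some (S1, L, State QA)"
| "M5 QB Sz = Some (Sx, R, State QB)"
| "M5 QB Sr = Some (Sb, R, State QA)"
| "M5 QC Sb = Some (Sz, L, State QC)"
| "M5 QC S1 = Some (Sx, R, State QC)"
| "M5 QC Sx = Some (S1, L, State QC)"
| "M5 QC Sa = Some (Sa, R, State QA)"
| "M5 QC Sz = Some (Sr, R, State QC)"
| "M5 QC Sr = Some (Sz, L, State QC)"
| "M5 QD Sb = Some (Sb, L, Halt)"
| "M5 QD S1 = Some (Sa, R, State QC)"
| "M5 QD Sx = None"
| "M5 QD Sa = None"
| "M5 QD Sz = Some (Sx, R, State QB)"
| "M5 QD Sr = None"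

text \<open>The word \<open>1\<^sup>n\<close> occupies the cells \<open>0, \<dots>, n - 1\<close> of an otherwise blank tape.\<close>

definition init5 :: "nat \<Rightarrow> (state5, symbol5) config" where
  "init5 n = (State QA, (\<lambda>i. if 0 \<le> i \<and> i < int n then S1 else Sb), 0)"

end

theory Submission
  imports Defs "HOL-Library.Stream"
begin

text \<open>
  Call a configuration \<open>n\<close>-block if the machine is in state \<open>A\<close> on the leftmost symbol of a word
  \<open>1\<^sup>n\<close> that has a blank on its left and only blanks on its right. The machine implements the map
  \<open>T\<close> on blocks: an \<open>n\<close>-block with \<open>n \<ge> 2\<close> leads to a \<open>T(n)\<close>-block (\<open>block_collatz\<close>), whereas a
  \<open>1\<close>-block halts at once (\<open>block_1_halts\<close>). Cells further left than the blank are never visited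
  again, which is why they may be arbitrary.

  The map is computed by halving with a tally. One round consumes two of the symbols \<open>1\<close>, writes
  \<open>xa\<close> in their place, runs to the right end of the tape and adds one symbol \<open>z\<close> there
  (\<open>halving_round\<close>). When \<open>n = 2k\<close> is even, the machine ends with \<open>(xa)\<^sup>k z\<^sup>k\<close>; it blanks the
  first \<open>z\<close>, which becomes the new separator, and rewrites the other ones and one blank behind
  them as \<open>1\<^sup>k\<close>. When \<open>n = 2k + 1\<close> is odd, it ends with \<open>(xa)\<^sup>k 1 z\<^sup>k\<close> and rewrites all these
  \<open>3k + 1\<close> symbols and one blank behind them as \<open>1\<close>: there are \<open>3k + 2 = (3n + 1) / 2\<close> of them.

  So a trajectory of \<open>T\<close> that reaches \<open>1\<close> yields a halting run. Conversely, the machine is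
  deterministic, so that a halting run passes through every block that its first block leads to.
  Each passage to the next block uses up at least one step; hence the trajectory of \<open>T\<close> must reach
  \<open>1\<close> within the length of the run.
\<close>

section \<open>Deterministic runs\<close>

lemma step_Halt [simp]: "\<not> step M (Halt, t, i) c"
  by (auto elim: step.cases)

lemma step_deterministic: "step M c d \<Longrightarrow> step M c d' \<Longrightarrow> d = d'"
  by (auto elim!: step.cases)

text \<open>
  Determinism makes a halting run pass through every configuration that its start leads to. The
  number of steps that remain is the quantity that decreases along a trajectory of \<open>T\<close>.
\<close>

lemma halting_run_shortens:
  assumes "(step M)\<^sup>+\<^sup>+ c d" and "(step M ^^ N) c (Halt, t, i)"
  shows "\<exists>N'<N. (step M ^^ N') d (Halt, t, i)"
proof -
  have one: "\<exists>N'<N. (step M ^^ N') d (Halt, t, i)"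
    if s: "step M c d" and h: "(step M ^^ N) c (Halt, t, i)" for c d N
  proof (cases N)
    case 0
    then show ?thesis using s h by simp
  next
    case (Suc N')
    then obtain e where "step M c e" "(step M ^^ N') e (Halt, t, i)"
      using h by (metis relpowp_Suc_E2)
    then show ?thesis using Suc s step_deterministic by blast
  qed
  show ?thesis using assms
  proof (induction rule: tranclp_induct)
    case (base d)
    then show ?case by (rule one)
  next
    case (step d e)
    then show ?case using one by (meson less_trans)
  qed
qed

section \<open>Tapes seen from the head\<close>

text \<open>
  A tape is split at the head into two streams: \<open>l\<close> lists the cells on the left, the nearest one
  first, and \<open>r\<close> lists the cells from the scanned one to the right. Moves of the head then
  transfer a symbol between the streams, and the position of the head can be forgotten.
\<close>

definition join_tape :: "'s stream \<Rightarrow> 's stream \<Rightarrow> int \<Rightarrow> int \<Rightarrow> 's" where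
  "join_tape l r i j = (if j < i then l !! nat (i - 1 - j) else r !! nat (j - i))"

type_synonym ('q, 's) local_config = "'q control \<times> 's stream \<times> 's stream"

fun place :: "('q, 's) local_config \<Rightarrow> int \<Rightarrow> ('q, 's) config" where
  "place (q, l, r) i = (q, join_tape l r i, i)"

text \<open>
  The configuration in which the head has just left the cells \<open>r\<close> towards the left. It is
  expressed through \<open>shd\<close> and \<open>stl\<close> because a sweep to the left ends on the symbol after the swept
  word, whatever it is and even if that word is empty.
\<close>

abbreviation leftwards :: "'q control \<Rightarrow> 's stream \<Rightarrow> 's stream \<Rightarrow> ('q, 's) local_config" where
  "leftwards q l r \<equiv> (q, stl l, shd l ## r)"

inductive local_step ::
  "('q, 's) machine \<Rightarrow> ('q, 's) local_config \<Rightarrow> ('q, 's) local_config \<Rightarrow> bool"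
  for M :: "('q, 's) machine" where
  right: "M p s = Some (s', R, q) \<Longrightarrow> local_step M (State p, l, s ## r) (q, s' ## l, r)"
| left: "M p s = Some (s', L, q) \<Longrightarrow> local_step M (State p, l, s ## r) (leftwards q l (s' ## r))"

lemma join_tape_move_right:
  "(join_tape l (s ## r) i)(i := s') = join_tape (s' ## l) r (i + 1)"
proof
  fix j :: int
  consider "j < i" | "j = i" | "j > i" by linarith
  then show "((join_tape l (s ## r) i)(i := s')) j = join_tape (s' ## l) r (i + 1) j"
  proof cases
    case 1
    then have "nat (i - j) = Suc (nat (i - 1 - j))" by simp
    with 1 show ?thesis by (simp add: join_tape_def)
  next
    case 2
    then show ?thesis by (simp add: join_tape_def)
  next
    case 3
    then have "nat (j - i) = Suc (nat (j - (i + 1)))" by simp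
    with 3 show ?thesis by (simp add: join_tape_def)
  qed
qed

lemma join_tape_move_left:
  "(join_tape l (s ## r) i)(i := s') = join_tape (stl l) (shd l ## s' ## r) (i - 1)"
proof -
  have "((join_tape l (s ## r) i)(i := s')) j = join_tape l (s' ## r) i j" for j
    by (cases "nat (j - i)") (auto simp: join_tape_def)
  then have "(join_tape l (s ## r) i)(i := s') = join_tape (shd l ## stl l) (s' ## r) (i - 1 + 1)"
    by (simp add: fun_eq_iff)
  also have "\<dots> = (join_tape (stl l) (shd l ## s' ## r) (i - 1))(i - 1 := shd l)"
    by (rule join_tape_move_right[symmetric])
  also have "\<dots> = join_tape (stl l) (shd l ## s' ## r) (i - 1)"
    by (simp add: fun_eq_iff join_tape_def)
  finally show ?thesis .
qed

lemma local_step_sound: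
  assumes "local_step M c d"
  shows "\<exists>i'. step M (place c i) (place d i')"
  using assms
proof cases
  case (right p s s' q l r)
  have "step M (State p, join_tape l (s ## r) i, i)
    (q, (join_tape l (s ## r) i)(i := s'), move R i)"
    by (rule step.intros) (simp add: join_tape_def right)
  then show ?thesis using right by (auto simp: join_tape_move_right)
next
  case (left p s s' q l r)
  have "step M (State p, join_tape l (s ## r) i, i)
    (q, (join_tape l (s ## r) i)(i := s'), move L i)"
    by (rule step.intros) (simp add: join_tape_def left)
  then show ?thesis using left by (auto simp: join_tape_move_left)
qed

lemma local_run_sound:
  assumes "(local_step M)\<^sup>+\<^sup>+ c d"
  shows "\<exists>i'. (step M)\<^sup>+\<^sup>+ (place c i) (place d i')"
  using assms
proof (induction rule: tranclp_induct)
  case (base d)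
  then show ?case using local_step_sound by blast
next
  case (step d e)
  then show ?case using local_step_sound by (meson tranclp.trancl_into_trancl)
qed

lemma replicate_shift_Cons: "replicate n s @- s ## r = replicate (Suc n) s @- r"
  by (induction n) auto

lemma sweep_right:
  assumes "M q s = Some (s', R, State q)"
  shows "(local_step M)\<^sup>*\<^sup>* (State q, l, replicate n s @- r) (State q, replicate n s' @- l, r)"
proof (induction n arbitrary: l)
  case (Suc n)
  have "local_step M (State q, l, s ## replicate n s @- r) (State q, s' ## l, replicate n s @- r)"
    using assms by (rule right)
  moreover note Suc[of "s' ## l"]
  ultimately show ?case
    unfolding replicate_shift_Cons
    by (simp add: converse_rtranclp_into_rtranclp)
qed simp

lemma sweep_left:
  assumes "M q s = Some (s', L, State q)"
  shows "(local_step M)\<^sup>*\<^sup>* (leftwards (State q) (replicate n s @- l) r)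
    (leftwards (State q) l (replicate n s' @- r))"
proof (induction n arbitrary: r)
  case (Suc n)
  have "local_step M (State q, replicate n s @- l, s ## r)
      (leftwards (State q) (replicate n s @- l) (s' ## r))"
    using assms by (rule left)
  moreover note Suc[of "s' ## r"]
  ultimately show ?case
    unfolding replicate_shift_Cons
    by (simp add: converse_rtranclp_into_rtranclp)
qed simp

section \<open>The passage from one block to the next\<close>

abbreviation run_step (infix "\<leadsto>" 50) where "c \<leadsto> d \<equiv> local_step M5 c d"
abbreviation run (infix "\<leadsto>\<^sup>*" 50) where "c \<leadsto>\<^sup>* d \<equiv> (local_step M5)\<^sup>*\<^sup>* c d"
abbreviation nonempty_run (infix "\<leadsto>\<^sup>+" 50) where "c \<leadsto>\<^sup>+ d \<equiv> (local_step M5)\<^sup>+\<^sup>+ c d"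

text \<open>
  These two rules keep the information that a run is not empty when calculations start with a step.
\<close>

lemma run_step_run_step [trans]: "c \<leadsto> d \<Longrightarrow> d \<leadsto> e \<Longrightarrow> c \<leadsto>\<^sup>+ e"
  by (blast intro: tranclp.intros)

lemma run_step_run [trans]: "c \<leadsto> d \<Longrightarrow> d \<leadsto>\<^sup>* e \<Longrightarrow> c \<leadsto>\<^sup>+ e"
  by (rule rtranclp_into_tranclp2)

definition blanks :: "symbol5 stream" where "blanks = sconst Sb"

definition block :: "nat \<Rightarrow> symbol5 stream \<Rightarrow> (state5, symbol5) local_config" where
  "block n l = (State QA, Sb ## l, replicate n S1 @- blanks)"

text \<open>The word \<open>(xa)\<^sup>k\<close> left behind by \<open>k\<close> rounds, read from the head to the left.\<close>

primrec trail :: "nat \<Rightarrow> symbol5 stream \<Rightarrow> symbol5 stream" where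
  "trail 0 l = l"
| "trail (Suc k) l = Sa ## Sx ## trail k l"

lemma blanks_unfold: "blanks = Sb ## blanks"
  unfolding blanks_def by (subst siterate.code) simp

lemma snth_blanks [simp]: "blanks !! k = Sb"
  by (metis blanks_def snth_sset sset_sconst singletonD)

text \<open>
  The states \<open>A\<close> and \<open>D\<close> replace two symbols \<open>1\<close> by \<open>xa\<close>. State \<open>C\<close> then fetches a \<open>z\<close>: on the
  way to the right it marks the cells that it passes (\<open>1\<close> by \<open>x\<close>, \<open>z\<close> by \<open>r\<close>), and the marked
  symbols send it back to the left while they are restored. The \<open>a\<close> just written stops it, which
  is why the pairs \<open>xa\<close> of earlier rounds stay intact.
\<close>

lemma halving_round:
  "(State QA, l, replicate (Suc (Suc m)) S1 @- replicate j Sz @- blanks) \<leadsto>\<^sup>+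
   (State QA, Sa ## Sx ## l, replicate m S1 @- replicate (Suc j) Sz @- blanks)"
proof -
  let ?l = "Sa ## Sx ## l"
  have "(State QA, l, replicate (Suc (Suc m)) S1 @- replicate j Sz @- blanks) \<leadsto>
      (State QD, Sx ## l, S1 ## replicate m S1 @- replicate j Sz @- blanks)"
    by (simp add: right)
  also have "\<dots> \<leadsto> (State QC, ?l, replicate m S1 @- replicate j Sz @- blanks)"
    by (simp add: right)
  also have "\<dots> \<leadsto>\<^sup>* (State QC, replicate m Sx @- ?l, replicate j Sz @- blanks)"
    by (rule sweep_right) simp
  also have "\<dots> \<leadsto>\<^sup>* (State QC, replicate j Sr @- replicate m Sx @- ?l, Sb ## blanks)"
    unfolding blanks_unfold[symmetric] by (rule sweep_right) simp
  also have "\<dots> \<leadsto> leftwards (State QC) (replicate j Sr @- replicate m Sx @- ?l) (Sz ## blanks)"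
    by (rule left) simp
  also have "\<dots> \<leadsto>\<^sup>* leftwards (State QC) (replicate m Sx @- ?l) (replicate j Sz @- Sz ## blanks)"
    by (rule sweep_left) simp
  also have "\<dots> \<leadsto>\<^sup>* leftwards (State QC) ?l (replicate m S1 @- replicate j Sz @- Sz ## blanks)"
    by (rule sweep_left) simp
  also have "\<dots> \<leadsto> (State QA, ?l, replicate m S1 @- replicate j Sz @- Sz ## blanks)"
    by (simp add: right)
  finally show ?thesis unfolding replicate_shift_Cons .
qed

lemma halving_rounds:
  "(State QA, trail k l, replicate (2 * d + m) S1 @- replicate j Sz @- blanks) \<leadsto>\<^sup>*
   (State QA, trail (k + d) l, replicate m S1 @- replicate (j + d) Sz @- blanks)"
proof (induction d arbitrary: k j)
  case (Suc d)
  show ?case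
    using halving_round[of "trail k l" "2 * d + m" j] Suc[of "Suc k" "Suc j"]
    by (simp del: replicate_Suc)
qed simp

text \<open>
  After an even number of symbols \<open>1\<close>, state \<open>A\<close> meets the tally. The first \<open>z\<close> is marked \<open>r\<close>, so
  that the sweep back can recognise it and make it the blank in front of the new block; the blank
  behind the tally, turned into \<open>1\<close>, compensates for this loss.
\<close>

lemma tally_becomes_block:
  "(State QA, l, replicate (Suc j) Sz @- blanks) \<leadsto>\<^sup>+ block (Suc j) l"
proof -
  have "(State QA, l, replicate (Suc j) Sz @- blanks) \<leadsto>
      (State QB, Sr ## l, replicate j Sz @- blanks)"
    by (simp add: right)
  also have "\<dots> \<leadsto>\<^sup>* (State QB, replicate j Sx @- Sr ## l, Sb ## blanks)"
    unfolding blanks_unfold[symmetric] by (rule sweep_right) simp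
  also have "\<dots> \<leadsto> leftwards (State QB) (replicate j Sx @- Sr ## l) (S1 ## blanks)"
    by (rule left) simp
  also have "\<dots> \<leadsto>\<^sup>* leftwards (State QB) (Sr ## l) (replicate j S1 @- S1 ## blanks)"
    by (rule sweep_left) simp
  also have "\<dots> \<leadsto> block (Suc j) l"
    unfolding block_def replicate_shift_Cons by (simp add: right)
  finally show ?thesis .
qed

lemma erase_trail:
  "leftwards (State QA) (trail k l) r \<leadsto>\<^sup>* leftwards (State QA) l (replicate (2 * k) S1 @- r)"
proof (induction k arbitrary: r)
  case (Suc k)
  have "leftwards (State QA) (trail (Suc k) l) r \<leadsto>
      leftwards (State QA) (Sx ## trail k l) (S1 ## r)"
    using left[of M5 QA Sa S1 "State QA" "Sx ## trail k l" r] by simp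
  also have "\<dots> \<leadsto> leftwards (State QA) (trail k l) (S1 ## S1 ## r)"
    using left[of M5 QA Sx S1 "State QA" "trail k l" "S1 ## r"] by simp
  also have "\<dots> \<leadsto>\<^sup>* leftwards (State QA) l (replicate (2 * k) S1 @- S1 ## S1 ## r)"
    by (rule Suc)
  finally show ?case
    by (simp add: replicate_shift_Cons tranclp_into_rtranclp)
qed simp

text \<open>
  After an odd number of symbols \<open>1\<close>, state \<open>D\<close> meets the tally, which must be non-empty: on a
  blank it would halt. No cell is marked \<open>r\<close>, so that the sweep back is stopped only by the blank
  in front of the trail. The new block has \<open>2(k + 1)\<close> symbols from the trail, one from the last
  \<open>1\<close>, \<open>j + 1\<close> from the tally and one from the blank behind it.
\<close>

lemma trail_becomes_block:
  "(State QA, trail (Suc k) (Sb ## l), S1 ## replicate (Suc j) Sz @- blanks) \<leadsto>\<^sup>+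
   block (2 * k + j + 5) l"
proof -
  let ?l = "trail (Suc k) (Sb ## l)"
  have "(State QA, ?l, S1 ## replicate (Suc j) Sz @- blanks) \<leadsto>
      (State QD, Sx ## ?l, Sz ## replicate j Sz @- blanks)"
    by (simp add: right)
  also have "\<dots> \<leadsto> (State QB, replicate 2 Sx @- ?l, replicate j Sz @- blanks)"
    by (simp add: right numeral_2_eq_2)
  also have "\<dots> \<leadsto>\<^sup>* (State QB, replicate j Sx @- replicate 2 Sx @- ?l, Sb ## blanks)"
    unfolding blanks_unfold[symmetric] by (rule sweep_right) simp
  also have "\<dots> \<leadsto> leftwards (State QB) (replicate j Sx @- replicate 2 Sx @- ?l) (S1 ## blanks)"
    by (rule left) simp
  also have "\<dots> \<leadsto>\<^sup>* leftwards (State QB) (replicate 2 Sx @- ?l) (replicate j S1 @- S1 ## blanks)"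
    by (rule sweep_left) simp
  also have "\<dots> \<leadsto>\<^sup>* leftwards (State QB) ?l (replicate 2 S1 @- replicate j S1 @- S1 ## blanks)"
    by (rule sweep_left) simp
  \<comment> \<open>State \<open>B\<close> hands over to \<open>A\<close> at the first \<open>a\<close>; \<open>A\<close> turns both symbols of the trail into \<open>1\<close>.\<close>
  also have "\<dots> = (State QB, Sx ## trail k (Sb ## l), Sa ## replicate (j + 3) S1 @- blanks)"
    by (simp add: replicate_shift_Cons numeral_eq_Suc)
  also have "\<dots> \<leadsto> leftwards (State QA) (Sx ## trail k (Sb ## l)) (replicate (j + 4) S1 @- blanks)"
    using left[of M5 QB Sa S1 "State QA" "Sx ## trail k (Sb ## l)"] by (simp add: numeral_eq_Suc)
  also have "\<dots> \<leadsto>\<^sup>* leftwards (State QA) (trail k (Sb ## l)) (replicate (j + 5) S1 @- blanks)"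
    using sweep_left[of M5 QA Sx S1 1] by (simp add: numeral_eq_Suc)
  also have "\<dots> \<leadsto>\<^sup>* leftwards (State QA) (Sb ## l)
      (replicate (2 * k) S1 @- replicate (j + 5) S1 @- blanks)"
    by (rule erase_trail)
  also have "\<dots> \<leadsto> block (2 * k + j + 5) l"
    unfolding block_def
    by (simp add: right replicate_add flip: shift_append)
  finally show ?thesis .
qed

lemma block_collatz:
  assumes "n \<ge> 2"
  shows "\<exists>l'. block n l \<leadsto>\<^sup>+ block (collatz_T n) l'"
proof (cases "even n")
  case True
  then obtain h where "n = 2 * h" by blast
  with assms obtain k where n: "n = 2 * Suc k" by (cases h) auto
  have "block n l \<leadsto>\<^sup>* (State QA, trail (Suc k) (Sb ## l), replicate (Suc k) Sz @- blanks)"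
    using halving_rounds[of 0 "Sb ## l" "Suc k" 0 0] unfolding block_def n
    by (simp del: replicate_Suc trail.simps(2))
  also have "\<dots> \<leadsto>\<^sup>+ block (Suc k) (trail (Suc k) (Sb ## l))"
    by (rule tally_becomes_block)
  finally show ?thesis unfolding collatz_T_def n by auto
next
  case False
  then obtain h where "n = 2 * h + 1" by (rule oddE)
  with assms obtain k where n: "n = 2 * Suc k + 1" by (cases h) auto
  have "block n l \<leadsto>\<^sup>* (State QA, trail (Suc k) (Sb ## l), S1 ## replicate (Suc k) Sz @- blanks)"
    using halving_rounds[of 0 "Sb ## l" "Suc k" 1 0] unfolding block_def n
    by (simp del: replicate_Suc trail.simps(2) add: replicate_Suc[of 0])
  also have "\<dots> \<leadsto>\<^sup>+ block (2 * k + k + 5) l"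
    by (rule trail_becomes_block)
  also have "2 * k + k + 5 = collatz_T n"
    unfolding collatz_T_def n by simp
  finally show ?thesis by blast
qed

text \<open>For \<open>n = 1\<close> there is no round and hence no tally, so that state \<open>D\<close> meets a blank.\<close>

lemma block_1_halts: "halts M5 (place (block 1 l) i)"
proof -
  have "block 1 l \<leadsto> (State QD, Sx ## Sb ## l, Sb ## blanks)"
    unfolding block_def blanks_unfold[symmetric] by (simp add: right)
  also have "\<dots> \<leadsto> (Halt, Sb ## l, Sx ## Sb ## blanks)"
    using left[of M5 QD Sb Sb Halt "Sx ## Sb ## l" blanks] by simp
  finally show ?thesis
    unfolding halts_def by (metis local_run_sound place.simps tranclp_into_rtranclp)
qed

section \<open>Halting and the trajectories of the map\<close>

lemma init5_eq_block: "init5 n = place (block n blanks) 0"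
proof -
  have "(replicate n S1 @- blanks) !! k = (if k < n then S1 else Sb)" for k
    by (simp add: shift_snth)
  then have "join_tape blanks (replicate n S1 @- blanks) 0 =
      (\<lambda>j. if 0 \<le> j \<and> j < int n then S1 else Sb)"
    by (auto simp: join_tape_def nat_less_iff)
  then show ?thesis
    by (simp only: init5_def block_def place.simps blanks_unfold[symmetric])
qed

lemma block_collatz_run:
  assumes "n \<ge> 2"
  obtains l' i' where "(step M5)\<^sup>+\<^sup>+ (place (block n l) i) (place (block (collatz_T n) l') i')"
  using block_collatz[OF assms] local_run_sound by metis

lemma collatz_T_pos: "n > 0 \<Longrightarrow> collatz_T n > 0"
  by (auto simp: collatz_T_def)

text \<open>
  The trajectory may have passed \<open>1\<close> before its \<open>j\<close>-th term; the machine halts at the first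
  occurrence of \<open>1\<close>, hence the case distinction on \<open>n\<close> in the induction step.
\<close>

lemma trajectory_to_1_halts:
  assumes "n > 0" and "(collatz_T ^^ j) n = 1"
  shows "halts M5 (place (block n l) i)"
  using assms
proof (induction j arbitrary: n l i)
  case 0
  then show ?case using block_1_halts by simp
next
  case (Suc j)
  show ?case
  proof (cases "n \<ge> 2")
    case True
    obtain l' i' where
      "(step M5)\<^sup>+\<^sup>+ (place (block n l) i) (place (block (collatz_T n) l') i')"
      using True by (rule block_collatz_run)
    moreover have "halts M5 (place (block (collatz_T n) l') i')"
      using Suc.IH Suc.prems collatz_T_pos by (simp add: funpow_Suc_right del: funpow.simps(2))
    ultimately show ?thesis
      unfolding halts_def by (meson rtranclp_trans tranclp_into_rtranclp)
  next
    case False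
    with Suc.prems have "n = 1" by simp
    then show ?thesis using block_1_halts by simp
  qed
qed

lemma halting_run_reaches_1:
  assumes "n > 0" and "(step M5 ^^ N) (place (block n l) i) (Halt, t, h)"
  shows "\<exists>j. (collatz_T ^^ j) n = 1"
  using assms
proof (induction N arbitrary: n l i rule: less_induct)
  case (less N)
  show ?case
  proof (cases "n \<ge> 2")
    case True
    obtain l' i' where
      "(step M5)\<^sup>+\<^sup>+ (place (block n l) i) (place (block (collatz_T n) l') i')"
      using True by (rule block_collatz_run)
    from halting_run_shortens[OF this less.prems(2)]
    obtain N' where N': "N' < N"
      "(step M5 ^^ N') (place (block (collatz_T n) l') i') (Halt, t, h)" by blast
    obtain j where "(collatz_T ^^ j) (collatz_T n) = 1"
      using less.IH[OF N'(1) collatz_T_pos[OF less.prems(1)] N'(2)] by (rule exE)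
    then have "(collatz_T ^^ Suc j) n = 1" by (simp add: funpow_Suc_right del: funpow.simps(2))
    then show ?thesis ..
  next
    case False
    with less.prems have "(collatz_T ^^ 0) n = 1" by simp
    then show ?thesis ..
  qed
qed

lemma halts_iff_reaches_1:
  assumes "n > 0"
  shows "halts M5 (init5 n) \<longleftrightarrow> (\<exists>j. (collatz_T ^^ j) n = 1)"
  unfolding init5_eq_block
  using assms trajectory_to_1_halts halting_run_reaches_1
  by (metis halts_def rtranclp_power)

lemma reaches_1_or_2_iff_reaches_1:
  "(\<exists>j. (collatz_T ^^ j) n \<in> {1, 2}) \<longleftrightarrow> (\<exists>j. (collatz_T ^^ j) n = 1)"
proof -
  have "(collatz_T ^^ Suc j) n = 1" if "(collatz_T ^^ j) n = 2" for j
    using that by (simp add: collatz_T_def)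
  then show ?thesis by blast
qed

theorem theorem5p2:
  shows "collatz_conjecture \<longleftrightarrow> (\<forall>n::nat. n > 0 \<longrightarrow> halts M5 (init5 n))"
  unfolding collatz_conjecture_def reaches_1_or_2_iff_reaches_1
  by (simp only: halts_iff_reaches_1 cong: imp_cong)

end
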